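(* Let $P$ be a $k$-regular contractible polycell. There is a bijection between the tilings of $P$ and the tensions $C$ on $P$ which satisfy: $C(e)=1$ for every edge $e\in\partial P$, and $C(e)\in\{1-k,1\}$ for every edge $e$ of $P$. (The bijection sends a tiling $Q$ to the flow $C_Q$.)
   Context: Let $G$ be a simple directed graph (no loops, no multiple edges, and if $(v,v')$ is an edge then $(v',v)$ is not). Fix a set $\Theta$ of elementary directed circuits of $G$, called cells. A polycell $P$ is a set of cells of $\Theta$; the edges (resp. vertices) of $P$ are the edges (resp. vertices) of its cells. $P$ is $k$-regular if every cell of $P$ is a circuit of length $k$. The boundary $\partial P$ is an arbitrarily distinguished set of edges of $P$; a vertex is on the boundary if it is an endpoint of an edge of $\partial P$. It is assumed that any set of cells of $P$ has at most one edge in common. For an edge $e$ of $P$ not in $\partial P$, the set of all cells of $P$ containing $e$ is called a tile. A tiling of $P$ is a partition of the set of cells of $P$ into tiles; for a tile $t$ of a tiling $Q$, the unique edge common to all cells of $t$ is a tiling edge of $Q$. A flow on $P$ is a map from the edges of $P$ to $\mathbb{Z}$. A travel from $s$ to $s'$ is a set of edges of $P$ which, when orientations are forgotten, forms a path from $s$ to $s'$; it is closed if it forms a cycle when orientations are forgotten. The flux of a flow $C$ on a travel $T$ is $F_T(C)=\sum_{e\in T^+}C(e)-\sum_{e\in T^-}C(e)$, where $T^+$ (resp. $T^-$) is the set of edges of $T$ traversed in (resp. against) their direction. For a cell $c$, $T_c$ is the closed travel consisting of the edges of $c$ (going around $c$). A flow $C$ is a tension if $F_T(C)=0$ for every closed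 travel $T$ in $P$. $P$ has a balanced boundary if, for a flow $C$ with $C(e)=1$ for all $e\in\partial P$, $F_T(C)=0$ for every closed travel $T$ consisting of edges of $\partial P$. $P$ is contractible if it has a balanced boundary and, for every flow $C$ on $P$, $C$ is a tension if and only if $F_{T_c}(C)=0$ for every cell $c$ of $P$. For a tiling $Q$ of a $k$-regular polycell $P$, the flow $C_Q$ is defined by $C_Q(e)=1-k$ if $e$ is a tiling edge of $Q$ and $C_Q(e)=1$ otherwise.
   Formalization: The assumption that any set of cells has at most one edge in common is imposed on sets with at least two cells; for a single cell c it is only required that at most one non-boundary edge has {c} as its tile, as the literal assumption is contradictory and without any the claim fails. *)

theory Defs
  imports
    Main
    "HOL-Library.Disjoint_Sets"
    "HOL-Library.FuncSet"
    "Graph_Theory.Graph_Theory"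
begin

text \<open>
  A circuit is represented by its set of arcs, so that it does not depend on a starting point;
  its length is the number of its arcs.
\<close>

definition elementary_circuit :: "'a pair_pre_digraph \<Rightarrow> ('a \<times> 'a) set \<Rightarrow> bool" where
  "elementary_circuit G c \<longleftrightarrow> (\<exists>p. pre_digraph.cycle (with_proj G) p \<and> set p = c)"

definition polycell_edges :: "('a \<times> 'a) set set \<Rightarrow> ('a \<times> 'a) set" where
  "polycell_edges P = \<Union>P"

definition polycell_vertices :: "('a \<times> 'a) set set \<Rightarrow> 'a set" where
  "polycell_vertices P = fst ` polycell_edges P \<union> snd ` polycell_edges P"

definition polycell_graph :: "('a \<times> 'a) set set \<Rightarrow> 'a pair_pre_digraph" where
  "polycell_graph P = \<lparr> pverts = polycell_vertices P, parcs = polycell_edges P \<rparr>"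

definition k_regular :: "nat \<Rightarrow> ('a \<times> 'a) set set \<Rightarrow> bool" where
  "k_regular k P \<longleftrightarrow> (\<forall>c\<in>P. card c = k)"

definition cells_at :: "('a \<times> 'a) set set \<Rightarrow> 'a \<times> 'a \<Rightarrow> ('a \<times> 'a) set set" where
  "cells_at P e = {c \<in> P. e \<in> c}"

definition tiles :: "('a \<times> 'a) set set \<Rightarrow> ('a \<times> 'a) set \<Rightarrow> ('a \<times> 'a) set set set" where
  "tiles P B = cells_at P ` (polycell_edges P - B)"

text \<open>
  No set of cells has more than one edge in common. Read literally this fails for a set consisting
  of one cell, which has all edges of that cell in common. For such a set it is only required that
  at most one edge outside the boundary defines it as a tile; without this the tiling edge of a
  one-cell tile would not be determined.
\<close>

definition common_edge_unique :: "('a \<times> 'a) set set \<Rightarrow> ('a \<times> 'a) set \<Rightarrow> bool" where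
  "common_edge_unique P B \<longleftrightarrow>
     (\<forall>S\<subseteq>P. (\<exists>c\<in>S. \<exists>c'\<in>S. c \<noteq> c') \<longrightarrow> (\<forall>e\<in>\<Inter>S. \<forall>e'\<in>\<Inter>S. e = e')) \<and>
     (\<forall>c\<in>P. \<forall>e\<in>c - B. \<forall>e'\<in>c - B. cells_at P e = {c} \<and> cells_at P e' = {c} \<longrightarrow> e = e')"

text \<open>
  \<open>G\<close> is the ambient graph, \<open>\<Theta>\<close> the set of cells, \<open>P\<close> the polycell and \<open>B\<close> its boundary.
\<close>

locale polycell = pair_loopfree_digraph G for G :: "'a pair_pre_digraph" +
  fixes \<Theta> P :: "('a \<times> 'a) set set" and B :: "('a \<times> 'a) set"
  assumes asymmetric: "(u, v) \<in> parcs G \<Longrightarrow> (v, u) \<notin> parcs G"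
    and cells_circuits: "c \<in> \<Theta> \<Longrightarrow> elementary_circuit G c"
    and polycell_subset: "P \<subseteq> \<Theta>"
    and boundary_subset: "B \<subseteq> polycell_edges P"
    and common_edge_unique: "common_edge_unique P B"

definition tilings :: "('a \<times> 'a) set set \<Rightarrow> ('a \<times> 'a) set \<Rightarrow> ('a \<times> 'a) set set set set" where
  "tilings P B = {Q. partition_on P Q \<and> Q \<subseteq> tiles P B}"

text \<open>
  A tiling edge is the edge defining a tile of the tiling. For a tile with at least two cells it is
  the only edge common to all its cells, as shown next.
\<close>

definition tiling_edges ::
    "('a \<times> 'a) set set \<Rightarrow> ('a \<times> 'a) set \<Rightarrow> ('a \<times> 'a) set set set \<Rightarrow> ('a \<times> 'a) set" where
  "tiling_edges P B Q = {e \<in> polycell_edges P - B. cells_at P e \<in> Q}"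

lemma common_edge_uniqueD:
  assumes "common_edge_unique P B"
  shows "S \<subseteq> P \<Longrightarrow> c \<in> S \<Longrightarrow> c' \<in> S \<Longrightarrow> c \<noteq> c' \<Longrightarrow>
           e \<in> \<Inter>S \<Longrightarrow> e' \<in> \<Inter>S \<Longrightarrow> e = e'"
    and "c \<in> P \<Longrightarrow> e \<in> c - B \<Longrightarrow> e' \<in> c - B \<Longrightarrow>
           cells_at P e = {c} \<Longrightarrow> cells_at P e' = {c} \<Longrightarrow> e = e'"
  using assms unfolding common_edge_unique_def by meson+

lemma (in polycell) Inter_tile:
  assumes "c \<in> cells_at P e" "c' \<in> cells_at P e" "c \<noteq> c'"
  shows "\<Inter>(cells_at P e) = {e}"
proof -
  have sub: "cells_at P e \<subseteq> P" and e: "e \<in> \<Inter>(cells_at P e)"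
    by (auto simp: cells_at_def)
  have "x = e" if "x \<in> \<Inter>(cells_at P e)" for x
    using common_edge_unique sub assms that e by (rule common_edge_uniqueD(1))
  with e show ?thesis by (intro equalityI subsetI) (simp_all only: singleton_iff)
qed

lemma (in polycell) inj_on_cells_at: "inj_on (cells_at P) (polycell_edges P - B)"
proof (rule inj_onI)
  fix e e'
  assume e: "e \<in> polycell_edges P - B" and e': "e' \<in> polycell_edges P - B"
    and eq: "cells_at P e = cells_at P e'"
  from e obtain c where c: "c \<in> P" "e \<in> c" by (auto simp: polycell_edges_def)
  then have ce: "c \<in> cells_at P e" by (simp add: cells_at_def)
  then have "c \<in> cells_at P e'" by (simp only: eq)
  then have c': "e' \<in> c" by (simp add: cells_at_def)
  show "e = e'"
  proof (cases "cells_at P e = {c}")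
    case True
    have "e \<in> c - B" "e' \<in> c - B" using c c' e e' by simp_all
    then show ?thesis
      using common_edge_uniqueD(2)[OF common_edge_unique c(1)] True True[unfolded eq] by blast
  next
    case False
    with ce obtain d where d: "d \<in> cells_at P e" "c \<noteq> d" by blast
    have "\<Inter>(cells_at P e) = {e}" by (rule Inter_tile[OF ce d])
    moreover have "\<Inter>(cells_at P e') = {e'}"
      by (rule Inter_tile[OF ce[unfolded eq] d(1)[unfolded eq] d(2)])
    ultimately have "{e} = {e'}" by (simp only: eq)
    then show ?thesis by (rule singleton_inject)
  qed
qed

text \<open>
  A flow on \<open>P\<close> is an extensional function, so that two flows are equal as soon as they agree on
  the edges of \<open>P\<close>.
\<close>

definition flows :: "('a \<times> 'a) set set \<Rightarrow> ('a \<times> 'a \<Rightarrow> int) set" where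
  "flows P = polycell_edges P \<rightarrow>\<^sub>E UNIV"

text \<open>
  A travel is represented by the set of ordered pairs \<open>(u, v)\<close> such that the travel goes from \<open>u\<close>
  to \<open>v\<close> along an edge, in or against its direction; this records both the set of edges and the
  sense of traversal. In a symmetrised digraph the cycles of length two are exactly the walks going
  back and forth along one edge, which are not cycles of the undirected graph.
\<close>

definition closed_travel :: "('a \<times> 'a) set set \<Rightarrow> ('a \<times> 'a) set \<Rightarrow> bool" where
  "closed_travel P T \<longleftrightarrow>
     (\<exists>p. pre_digraph.cycle (with_proj (mk_symmetric (with_proj (polycell_graph P)))) p \<and>
          3 \<le> length p \<and> set p = T)"

definition flux ::
    "('a \<times> 'a) set set \<Rightarrow> ('a \<times> 'a) set \<Rightarrow> ('a \<times> 'a \<Rightarrow> int) \<Rightarrow> int" where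
  "flux P T C = (\<Sum>e\<in>T \<inter> polycell_edges P. C e) - (\<Sum>e\<in>T\<inverse> \<inter> polycell_edges P. C e)"

definition tension :: "('a \<times> 'a) set set \<Rightarrow> ('a \<times> 'a \<Rightarrow> int) \<Rightarrow> bool" where
  "tension P C \<longleftrightarrow> C \<in> flows P \<and> (\<forall>T. closed_travel P T \<longrightarrow> flux P T C = 0)"

definition balanced_boundary :: "('a \<times> 'a) set set \<Rightarrow> ('a \<times> 'a) set \<Rightarrow> bool" where
  "balanced_boundary P B \<longleftrightarrow>
     (\<forall>C\<in>flows P. (\<forall>e\<in>B. C e = 1) \<longrightarrow>
        (\<forall>T. closed_travel P T \<and> T \<subseteq> B \<union> B\<inverse> \<longrightarrow> flux P T C = 0))"

text \<open>
  A cell \<open>c\<close>, being a set of arcs, is itself the closed travel going around \<open>c\<close>.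
\<close>

lemma (in polycell) closed_travel_cell:
  assumes "c \<in> P"
  shows "closed_travel P c" "flux P c C = (\<Sum>e\<in>c. C e)"
proof -
  have arcs: "d \<subseteq> parcs G" if d: "d \<in> P" for d
    using cells_circuits[of d] polycell_subset d
    by (auto simp: elementary_circuit_def pre_digraph.cycle_def pre_digraph.awalk_def)
  have sub: "c \<subseteq> polycell_edges P" and edges: "polycell_edges P \<subseteq> parcs G"
    using assms arcs by (auto simp: polycell_edges_def)
  obtain p u where p: "set p = c" "p \<noteq> []" "pcas u p u" "distinct (tl (pawalk_verts u p))"
    using cells_circuits[of c] polycell_subset assms
    by (auto simp: elementary_circuit_def pre_digraph.cycle_def pre_digraph.awalk_def
        cas_with_proj_eq awalk_verts_with_proj_eq)
  have len: "3 \<le> length p"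
  proof (rule ccontr)
    assume "\<not> 3 \<le> length p"
    then consider e where "p = [e]" | e e' where "p = [e, e']"
      using p(2) by (cases p rule: remdups_adj.cases) (auto simp: Suc_le_eq)
    then show False
    proof cases
      case 1
      then show False using p arcs[OF assms] pair_no_loops[of e] by auto
    next
      case 2
      then have "e' = (snd e, fst e)" using p(3) by (auto simp: prod_eq_iff)
      then show False
        using 2 p(1) arcs[OF assms] asymmetric[of "fst e" "snd e"] by auto
    qed
  qed
  have "u \<in> polycell_vertices P"
  proof -
    have "fst (hd p) = u" using p by (cases p) auto
    moreover have "hd p \<in> polycell_edges P" using p sub by auto
    ultimately show ?thesis by (auto simp: polycell_vertices_def)
  qed
  moreover have "c \<subseteq> parcs (mk_symmetric (with_proj (polycell_graph P)))"
  proof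
    fix e assume "e \<in> c"
    with sub have "e \<in> polycell_edges P" by (rule subsetD)
    then show "e \<in> parcs (mk_symmetric (with_proj (polycell_graph P)))"
      unfolding parcs_mk_symmetric
      by (intro UN_I[of e]) (simp_all add: polycell_graph_def)
  qed
  ultimately have "pre_digraph.awalk (with_proj (mk_symmetric (with_proj (polycell_graph P)))) u p u"
    using p by (simp add: pre_digraph.awalk_def cas_with_proj_eq polycell_graph_def)
  then have
    "pre_digraph.cycle (with_proj (mk_symmetric (with_proj (polycell_graph P)))) p"
    using p(2,4) unfolding pre_digraph.cycle_def awalk_verts_with_proj_eq
    by (intro exI[of _ u] conjI)
  then show "closed_travel P c"
    using len p(1) unfolding closed_travel_def by blast
  have "c\<inverse> \<inter> polycell_edges P = {}"
  proof (intro equals0I, elim IntE converseE)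
    fix e u v
    assume "e = (v, u)" "(u, v) \<in> c" "e \<in> polycell_edges P"
    then have "(u, v) \<in> parcs G" "(v, u) \<in> parcs G"
      using arcs[OF assms] edges by (simp_all add: subsetD)
    then show False using asymmetric by simp
  qed
  moreover have "c \<inter> polycell_edges P = c" using sub by blast
  ultimately show "flux P c C = (\<Sum>e\<in>c. C e)"
    by (simp add: flux_def)
qed

definition contractible :: "('a \<times> 'a) set set \<Rightarrow> ('a \<times> 'a) set \<Rightarrow> bool" where
  "contractible P B \<longleftrightarrow>
     balanced_boundary P B \<and>
     (\<forall>C\<in>flows P. tension P C \<longleftrightarrow> (\<forall>c\<in>P. flux P c C = 0))"

definition tiling_flow ::
    "nat \<Rightarrow> ('a \<times> 'a) set set \<Rightarrow> ('a \<times> 'a) set \<Rightarrow> ('a \<times> 'a) set set set \<Rightarrow> 'a \<times> 'a \<Rightarrow> int" where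
  "tiling_flow k P B Q =
     (\<lambda>e\<in>polycell_edges P. if e \<in> tiling_edges P B Q then 1 - int k else 1)"

end

theory Submission
  imports Defs
begin

text \<open>
  A tiling is the same thing as a set of inner edges meeting every cell exactly once. On the other
  hand, a flow with values in \<open>{1 - k, 1}\<close> has flux \<open>k - k * m\<close> around a cell with \<open>m\<close> edges of
  value \<open>1 - k\<close>, so by contractibility it is a tension iff those edges meet every cell exactly once.
\<close>

context polycell
begin

lemma finite_cell: "c \<in> P \<Longrightarrow> finite c"
  and cell_nonempty: "c \<in> P \<Longrightarrow> c \<noteq> {}"
  using cells_circuits polycell_subset
  by (force simp: elementary_circuit_def pre_digraph.cycle_def)+

text \<open>Inner edges with the same cells coincide, so no edge outside \<open>F\<close> can define
  a tile of the image. This includes one-cell tiles, whose cell has many edges.\<close>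

lemma tiling_edges_image:
  assumes "F \<subseteq> polycell_edges P - B"
  shows "tiling_edges P B (cells_at P ` F) = F"
proof -
  have "cells_at P e \<in> cells_at P ` F \<longleftrightarrow> e \<in> F" if "e \<in> polycell_edges P - B" for e
    using inj_on_cells_at that assms by (rule inj_on_image_mem_iff)
  then show ?thesis using assms unfolding tiling_edges_def by blast
qed

text \<open>Every tile comes from some inner edge. With the previous lemma, tilings thus correspond
  one-to-one to those sets of inner edges whose tiles form a tiling.\<close>

lemma image_tiling_edges:
  assumes "Q \<in> tilings P B"
  shows "cells_at P ` tiling_edges P B Q = Q"
  using assms by (auto simp: tilings_def tiles_def tiling_edges_def)

text \<open>A cell lies in the tile at \<open>e\<close> exactly when \<open>e\<close> is one of its
  edges. Hence covering \<open>P\<close> means at least one edge of \<open>F\<close> in each cell,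
  and disjointness of the tiles means at most one.\<close>

lemma image_mem_tilings_iff:
  assumes F: "F \<subseteq> polycell_edges P - B"
  shows "cells_at P ` F \<in> tilings P B \<longleftrightarrow> (\<forall>c\<in>P. \<exists>!e. e \<in> c \<inter> F)"
proof
  assume "cells_at P ` F \<in> tilings P B"
  then have part: "partition_on P (cells_at P ` F)" by (simp add: tilings_def)
  show "\<forall>c\<in>P. \<exists>!e. e \<in> c \<inter> F"
  proof
    fix c assume c: "c \<in> P"
    then obtain e where e: "e \<in> F" "c \<in> cells_at P e"
      using partition_onD1[OF part] by blast
    show "\<exists>!e. e \<in> c \<inter> F"
    proof (rule ex1I[of _ e])
      show "e \<in> c \<inter> F" using e by (simp add: cells_at_def)
      fix e' assume e': "e' \<in> c \<inter> F"
      then have "c \<in> cells_at P e'" using c by (simp add: cells_at_def)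
      \<comment> \<open>Disjointness only identifies the two tiles that share \<open>c\<close>;
        injectivity of \<open>cells_at P\<close> on inner edges then identifies the edges.\<close>
      then have "cells_at P e' = cells_at P e"
        using e e' partition_onD2[OF part] unfolding disjoint_def by blast
      then show "e' = e" using inj_onD[OF inj_on_cells_at] e e' F by blast
    qed
  qed
next
  assume unique: "\<forall>c\<in>P. \<exists>!e. e \<in> c \<inter> F"
  have "partition_on P (cells_at P ` F)"
  proof (rule partition_onI)
    show "\<Union>(cells_at P ` F) = P" using unique by (auto simp: cells_at_def)
    show "disjnt s t" if "s \<in> cells_at P ` F" "t \<in> cells_at P ` F" "s \<noteq> t" for s t
      using that unique by (auto simp: cells_at_def disjnt_def)
    show "{} \<notin> cells_at P ` F"
      using F unfolding cells_at_def polycell_edges_def by blast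
  qed
  then show "cells_at P ` F \<in> tilings P B" using F by (auto simp: tilings_def tiles_def)
qed

lemma two_valued_flux_eq_0_iff:
  assumes reg: "k_regular k P" and c: "c \<in> P"
    and C: "\<And>e. e \<in> c \<Longrightarrow> C e = (if e \<in> F then 1 - int k else 1)"
  shows "flux P c C = 0 \<longleftrightarrow> (\<exists>!e. e \<in> c \<inter> F)"
proof -
  have k: "card c = k" using reg c by (simp add: k_regular_def)
  \<comment> \<open>This permits cancelling the factor \<open>k\<close> of the flux below.\<close>
  then have "k \<noteq> 0" using finite_cell[OF c] cell_nonempty[OF c] by auto
  have "flux P c C = (\<Sum>e\<in>c. 1 - (if e \<in> F then int k else 0))"
    unfolding closed_travel_cell(2)[OF c] by (intro sum.cong) (auto simp: C)
  also have "\<dots> = int k - int k * int (card (c \<inter> F))"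
    using finite_cell[OF c] k by (simp add: sum_subtractf sum.If_cases Int_def mult.commute)
  also have "\<dots> = int k * (1 - int (card (c \<inter> F)))"
    by (simp add: algebra_simps)
  finally have "flux P c C = 0 \<longleftrightarrow> card (c \<inter> F) = 1" using \<open>k \<noteq> 0\<close> by auto
  also have "\<dots> \<longleftrightarrow> (\<exists>!e. e \<in> c \<inter> F)"
    unfolding is_singleton_altdef[symmetric] is_singleton_def
    by (simp only: set_eq_iff singleton_iff Ex1_def, intro iff_exI) blast
  finally show ?thesis .
qed

text \<open>Contractibility reduces all closed travels to the cells, where the flux criterion and
  the tiling criterion are the same condition on \<open>F\<close>. Both directions of the bijection
  rest on this equivalence.\<close>

lemma two_valued_tension_iff:
  assumes reg: "k_regular k P" and con: "contractible P B"
    and F: "F \<subseteq> polycell_edges P - B" and flow: "C \<in> flows P"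
    and C: "\<And>e. e \<in> polycell_edges P \<Longrightarrow> C e = (if e \<in> F then 1 - int k else 1)"
  shows "tension P C \<longleftrightarrow> cells_at P ` F \<in> tilings P B"
proof -
  have "tension P C \<longleftrightarrow> (\<forall>c\<in>P. flux P c C = 0)"
    using con flow by (simp add: contractible_def)
  also have "\<dots> \<longleftrightarrow> (\<forall>c\<in>P. \<exists>!e. e \<in> c \<inter> F)"
    by (intro ball_cong refl two_valued_flux_eq_0_iff[OF reg] C)
       (auto simp: polycell_edges_def)
  finally show ?thesis by (simp only: image_mem_tilings_iff[OF F])
qed

end

theorem theorem1:
  fixes G :: "'a pair_pre_digraph"
    and \<Theta> P :: "('a \<times> 'a) set set"
    and B :: "('a \<times> 'a) set"
    and k :: nat
  assumes "polycell G \<Theta> P B"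
    and "k_regular k P"
    and "contractible P B"
  shows "bij_betw (tiling_flow k P B)
           (tilings P B)
           {C. tension P C \<and> (\<forall>e\<in>B. C e = 1) \<and> (\<forall>e\<in>polycell_edges P. C e \<in> {1 - int k, 1})}"
proof -
  interpret polycell G \<Theta> P B by fact
  let ?tensions = "{C. tension P C \<and> (\<forall>e\<in>B. C e = 1) \<and> (\<forall>e\<in>polycell_edges P. C e \<in> {1 - int k, 1})}"
  let ?heavy = "\<lambda>C. {e \<in> polycell_edges P. C e = 1 - int k}"
  \<comment> \<open>This keeps the values \<open>1 - k\<close> and \<open>1\<close> apart, so a flow
    determines its edges of value \<open>1 - k\<close>. An edge is assumed because the empty
    polycell is \<open>0\<close>-regular too.\<close>
  have k: "k \<noteq> 0" if "e \<in> polycell_edges P" for e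
  proof -
    obtain c where "c \<in> P" "e \<in> c"
      using \<open>e \<in> polycell_edges P\<close> unfolding polycell_edges_def by blast
    have "card c = k" using assms(2) \<open>c \<in> P\<close> by (simp add: k_regular_def)
    moreover have "card c \<noteq> 0"
      unfolding card_0_eq[OF finite_cell[OF \<open>c \<in> P\<close>]] using \<open>e \<in> c\<close> by blast
    ultimately show ?thesis by simp
  qed
  have inner: "tiling_edges P B Q \<subseteq> polycell_edges P - B" for Q
    by (auto simp: tiling_edges_def)
  show ?thesis
  \<comment> \<open>The inverse sends a flow to the tiles at its edges of value
    \<open>1 - k\<close>.\<close>
  proof (rule bij_betw_byWitness[where f' = "\<lambda>C. cells_at P ` ?heavy C"];
      (intro ballI image_subsetI)?)
    fix Q assume Q: "Q \<in> tilings P B"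
    have "?heavy (tiling_flow k P B Q) = tiling_edges P B Q"
      using inner[of Q] k by (auto simp: tiling_flow_def)
    then show "cells_at P ` ?heavy (tiling_flow k P B Q) = Q"
      by (simp only: image_tiling_edges[OF Q])
    show "tiling_flow k P B Q \<in> ?tensions"
    proof (intro CollectI conjI)
      show "tension P (tiling_flow k P B Q)"
        using Q
        by (subst two_valued_tension_iff[OF assms(2,3) inner])
           (auto simp: tiling_flow_def flows_def image_tiling_edges)
      show "\<forall>e\<in>B. tiling_flow k P B Q e = 1"
        using inner[of Q] boundary_subset by (auto simp: tiling_flow_def)
      show "\<forall>e\<in>polycell_edges P. tiling_flow k P B Q e \<in> {1 - int k, 1}"
        by (simp add: tiling_flow_def)
    qed
  next
    fix C assume "C \<in> ?tensions"
    then have C: "tension P C" "\<forall>e\<in>B. C e = 1" "\<forall>e\<in>polycell_edges P. C e \<in> {1 - int k, 1}"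
      by blast+
    \<comment> \<open>The value \<open>1\<close> on the boundary excludes boundary edges, so the
      remaining ones do define tiles.\<close>
    have heavy: "?heavy C \<subseteq> polycell_edges P - B" using C(2) k by auto
    have flow: "C \<in> flows P" using C(1) by (simp add: tension_def)
    have two_valued: "C e = (if e \<in> ?heavy C then 1 - int k else 1)" if "e \<in> polycell_edges P" for e
      using C(3) that by auto
    show "cells_at P ` ?heavy C \<in> tilings P B"
      using C(1) two_valued_tension_iff[OF assms(2,3) heavy flow two_valued] by (rule rev_iffD1)
    show "tiling_flow k P B (cells_at P ` ?heavy C) = C"
    proof
      fix e
      show "tiling_flow k P B (cells_at P ` ?heavy C) e = C e"
        unfolding tiling_flow_def tiling_edges_image[OF heavy]
        \<comment> \<open>Off the edges of \<open>P\<close> both sides are \<open>undefined\<close>,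
          since flows are extensional.\<close>
        using two_valued[of e] flow by (cases "e \<in> polycell_edges P") (auto simp: flows_def)
    qed
  qed
qed

end
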